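(* Fix $d\geq1$ and suppose that $\varphi= CI$ for a constant $C\neq0$ and an inner function $I$ on $\mathbb{T}^d$. Then $\varphi$ is a Hilbert point in $H^p(\mathbb{T}^d)$ for every $1 \leq p \leq \infty$.
   Context: $\mathbb{T}^d$ is the $d$-dimensional torus with normalized Haar measure $m_d$; $\widehat f(\alpha)=\int_{\mathbb{T}^d} f(z)\overline{z^\alpha}\,dm_d(z)$ for $\alpha\in\mathbb{Z}^d$. The Hardy space $H^p(\mathbb{T}^d)$ is the closed subspace of $L^p(\mathbb{T}^d)$ of functions $f$ with $\widehat f(\alpha)=0$ for all $\alpha\in\mathbb{Z}^d\setminus\mathbb{N}_0^d$, $\mathbb{N}_0=\{0,1,2,\ldots\}$, with the $L^p$ norm $\|\cdot\|_{H^p(\mathbb{T}^d)}$. Write $\langle f,g\rangle=\int_{\mathbb{T}^d} f\overline g\,dm_d$. A function $I$ in $H^p(\mathbb{T}^d)$ is called inner if $|I(z)|=1$ for almost every $z\in\mathbb{T}^d$. A nontrivial (i.e. not a.e. zero) function $\varphi$ in $H^p(\mathbb{T}^d)$, $1\le p\le\infty$, is a Hilbert point in $H^p(\mathbb{T}^d)$ if $\|\varphi\|_{H^p(\mathbb{T}^d)}\le\|\varphi+f\|_{H^p(\mathbb{T}^d)}$ for every $f\in H^p(\mathbb{T}^d)$ such that $\langle f,\varphi\rangle=0$. When $1\le p<2$, the condition $\langle f,\varphi\rangle=0$ is declared to mean that $f$ lies in the closure in $H^p(\mathbb{T}^d)$ of the set of analytic polynomials $g$ with $\langle g,\varphi\rangle=0$.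 *)

theory Defs
  imports "HOL-Probability.Probability"
begin

text \<open>
  The \<open>d\<close>-dimensional torus is indexed by a finite type \<open>'d\<close> with \<open>d = CARD('d)\<close>.  Elements of
  Lebesgue and Hardy spaces are represented by functions, not by classes modulo a.e. equality.
\<close>

definition circle :: "complex measure" where
  "circle = distr (uniform_measure lborel {0..2*pi}) (restrict_space borel (sphere 0 1)) cis"

definition torus :: "('d::finite \<Rightarrow> complex) measure" where
  "torus = PiM UNIV (\<lambda>_. circle)"

lemma measurable_cis_circle:
  "cis \<in> measurable (uniform_measure lborel {0..2*pi}) (restrict_space borel (sphere 0 1))"
proof -
  have "cis \<in> borel_measurable borel"
    by (intro borel_measurable_continuous_onI continuous_intros)
  then show ?thesis
    by (intro measurable_restrict_space2) (auto simp: measurable_def)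
qed

lemma prob_space_circle: "prob_space circle"
  unfolding circle_def
  by (intro prob_space.prob_space_distr prob_space_uniform_measure measurable_cis_circle) auto

lemma prob_space_torus: "prob_space torus"
  unfolding torus_def by (intro prob_space_PiM prob_space_circle)

lemma space_torus: "space torus = {z. \<forall>i. cmod (z i) = 1}"
  by (auto simp: torus_def circle_def space_PiM space_restrict_space PiE_def Pi_def)

definition monomial :: "('d::finite \<Rightarrow> int) \<Rightarrow> ('d \<Rightarrow> complex) \<Rightarrow> complex" where
  "monomial \<alpha> z = (\<Prod>i\<in>UNIV. z i powi \<alpha> i)"

definition fourier_coeff :: "(('d::finite \<Rightarrow> complex) \<Rightarrow> complex) \<Rightarrow> ('d \<Rightarrow> int) \<Rightarrow> complex" where
  "fourier_coeff f \<alpha> = (LINT z|torus. f z * cnj (monomial \<alpha> z))"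

definition pairing :: "(('d::finite \<Rightarrow> complex) \<Rightarrow> complex) \<Rightarrow> (('d \<Rightarrow> complex) \<Rightarrow> complex) \<Rightarrow> complex" where
  "pairing f g = (LINT z|torus. f z * cnj (g z))"

definition Lp :: "ennreal \<Rightarrow> (('d::finite \<Rightarrow> complex) \<Rightarrow> complex) set" where
  "Lp p = {f \<in> borel_measurable torus.
     if p = \<infinity> then esssup torus (\<lambda>z. ennreal (cmod (f z))) < \<infinity>
     else integrable torus (\<lambda>z. cmod (f z) powr enn2real p)}"

text \<open>Meaningful only for functions in \<open>Lp p\<close>; elsewhere the value is junk.\<close>

definition Lp_norm :: "ennreal \<Rightarrow> (('d::finite \<Rightarrow> complex) \<Rightarrow> complex) \<Rightarrow> real" where
  "Lp_norm p f =
     (if p = \<infinity> then enn2real (esssup torus (\<lambda>z. ennreal (cmod (f z))))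
      else (LINT z|torus. cmod (f z) powr enn2real p) powr (1 / enn2real p))"

definition Hardy :: "ennreal \<Rightarrow> (('d::finite \<Rightarrow> complex) \<Rightarrow> complex) set" where
  "Hardy p = {f \<in> Lp p. \<forall>\<alpha>. (\<exists>i. \<alpha> i < 0) \<longrightarrow> fourier_coeff f \<alpha> = 0}"

text \<open>Being inner does not depend on the exponent, since unimodular measurable functions lie in
  every \<open>Lp p\<close>; so membership in some Hardy space is all that is asked.\<close>

definition inner_function :: "(('d::finite \<Rightarrow> complex) \<Rightarrow> complex) \<Rightarrow> bool" where
  "inner_function I \<longleftrightarrow> (\<exists>p\<ge>1. I \<in> Hardy p) \<and> (AE z in torus. cmod (I z) = 1)"

definition analytic_polynomial :: "(('d::finite \<Rightarrow> complex) \<Rightarrow> complex) \<Rightarrow> bool" where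
  "analytic_polynomial g \<longleftrightarrow>
     (\<exists>A c. finite A \<and> (\<forall>\<alpha>\<in>A. \<forall>i. 0 \<le> \<alpha> i) \<and> g = (\<lambda>z. \<Sum>\<alpha>\<in>A. c \<alpha> * monomial \<alpha> z))"

definition Hardy_closure ::
  "ennreal \<Rightarrow> (('d::finite \<Rightarrow> complex) \<Rightarrow> complex) set \<Rightarrow> (('d \<Rightarrow> complex) \<Rightarrow> complex) set" where
  "Hardy_closure p S = {f \<in> Hardy p. \<forall>\<epsilon>>0. \<exists>g\<in>S. Lp_norm p (\<lambda>z. f z - g z) < \<epsilon>}"

text \<open>For \<open>p < 2\<close> the product of two functions in \<open>Hardy p\<close> need not be integrable, so
  orthogonality is defined by approximation with polynomials.\<close>

definition orthogonal_to ::
  "ennreal \<Rightarrow> (('d::finite \<Rightarrow> complex) \<Rightarrow> complex) \<Rightarrow> (('d \<Rightarrow> complex) \<Rightarrow> complex) \<Rightarrow> bool" where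
  "orthogonal_to p f \<phi> \<longleftrightarrow>
     (if p < 2 then f \<in> Hardy_closure p {g. analytic_polynomial g \<and> pairing g \<phi> = 0}
      else pairing f \<phi> = 0)"

definition Hilbert_point :: "ennreal \<Rightarrow> (('d::finite \<Rightarrow> complex) \<Rightarrow> complex) \<Rightarrow> bool" where
  "Hilbert_point p \<phi> \<longleftrightarrow>
     1 \<le> p \<and> \<phi> \<in> Hardy p \<and> \<not> (AE z in torus. \<phi> z = 0) \<and>
     (\<forall>f\<in>Hardy p. orthogonal_to p f \<phi> \<longrightarrow> Lp_norm p \<phi> \<le> Lp_norm p (\<lambda>z. \<phi> z + f z))"

end

theory Submission
  imports Defs
begin

text \<open>Since \<open>\<phi>\<close> has constant modulus \<open>\<bar>C\<bar>\<close>, the pairing with \<open>\<phi>\<close> is continuous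
  already in the \<open>L\<^sup>1\<close> norm, so \<open>\<langle>f, \<phi>\<rangle> = 0\<close> also for the \<open>f\<close> that are orthogonal in the sense of
  closures.  Then \<open>\<bar>C\<bar>\<^sup>2 = \<langle>\<phi> + f, \<phi>\<rangle> \<le> \<bar>C\<bar> \<parallel>\<phi> + f\<parallel>\<^sub>1 \<le> \<bar>C\<bar> \<parallel>\<phi> + f\<parallel>\<^sub>p\<close>, whereas
  \<open>\<parallel>\<phi>\<parallel>\<^sub>p = \<bar>C\<bar>\<close>.\<close>

interpretation torus: prob_space torus
  by (rule prob_space_torus)

section \<open>Membership and integrability in L^p over a space of total mass one\<close>

lemma powr_add_le:
  fixes a b r :: real
  assumes "0 \<le> a" "0 \<le> b" "0 \<le> r"
  shows "(a + b) powr r \<le> 2 powr r * (a powr r + b powr r)"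
proof -
  have "(a + b) powr r \<le> (2 * max a b) powr r"
    using assms by (intro powr_mono2) auto
  also have "\<dots> = 2 powr r * max a b powr r"
    using assms by (simp add: powr_mult)
  also have "\<dots> \<le> 2 powr r * (a powr r + b powr r)"
    by (intro mult_left_mono) (auto simp: max_def)
  finally show ?thesis .
qed

lemma one_le_enn2real:
  assumes "1 \<le> p" "p \<noteq> \<infinity>"
  shows "1 \<le> enn2real p"
  using assms by (cases p) (auto simp: top_unique)

lemma LpD_measurable: "f \<in> Lp p \<Longrightarrow> f \<in> borel_measurable torus"
  by (simp add: Lp_def)

lemma Lp_top_AE_le:
  assumes "f \<in> Lp \<infinity>"
  shows "AE z in torus. cmod (f z) \<le> Lp_norm \<infinity> f"
proof -
  \<comment> \<open>Membership in \<open>Lp \<infinity>\<close> makes the essential supremum finite,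
    so \<open>enn2real\<close> in the norm loses nothing.\<close>
  have eq: "esssup torus (\<lambda>z. ennreal (cmod (f z))) = ennreal (Lp_norm \<infinity> f)"
    using assms by (simp add: Lp_def Lp_norm_def)
  have nonneg: "0 \<le> Lp_norm \<infinity> f"
    by (simp add: Lp_norm_def)
  have "AE z in torus. ennreal (cmod (f z)) \<le> ennreal (Lp_norm \<infinity> f)"
    unfolding eq[symmetric] by (rule esssup_AE)
  then show ?thesis
    by (simp only: ennreal_le_iff[OF nonneg])
qed

text \<open>Total mass one puts bounded functions in every \<open>Lp p\<close>; this lets a function
  of constant modulus change its exponent.\<close>

lemma Lp_bounded:
  assumes [measurable]: "f \<in> borel_measurable torus"
    and bound: "AE z in torus. cmod (f z) \<le> B"
  shows "f \<in> Lp p"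
proof (cases "p = \<infinity>")
  case True
  have "esssup torus (\<lambda>z. ennreal (cmod (f z))) \<le> ennreal B"
    using bound by (intro esssup_I) (auto elim!: eventually_mono intro: ennreal_leI)
  also have "\<dots> < \<infinity>" by simp
  finally show ?thesis
    using True by (simp add: Lp_def)
next
  case False
  have "integrable torus (\<lambda>z. cmod (f z) powr enn2real p)"
    using bound
    by (intro torus.integrable_const_bound[of _ "B powr enn2real p"])
      (auto elim!: eventually_mono intro!: powr_mono2)
  then show ?thesis
    using False by (simp add: Lp_def)
qed

text \<open>Only membership is at stake, so for finite \<open>p\<close> the crude bound
  \<open>powr_add_le\<close> takes the place of Minkowski's inequality; it covers every exponent
  \<open>r \<ge> 0\<close>, also below 1.\<close>

lemma Lp_add:
  assumes f: "f \<in> Lp p" and g: "g \<in> Lp p"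
  shows "(\<lambda>z. f z + g z) \<in> Lp p"
proof -
  note [measurable] = LpD_measurable[OF f] LpD_measurable[OF g]
  show ?thesis
  proof (cases "p = \<infinity>")
    case True
    have "AE z in torus. cmod (f z + g z) \<le> Lp_norm \<infinity> f + Lp_norm \<infinity> g"
      using Lp_top_AE_le[OF f[unfolded True]] Lp_top_AE_le[OF g[unfolded True]]
      by eventually_elim (meson add_mono norm_triangle_ineq order_trans)
    then show ?thesis
      by (intro Lp_bounded) auto
  next
    case False
    define r where "r = enn2real p"
    have int: "integrable torus (\<lambda>z. cmod (f z) powr r)" "integrable torus (\<lambda>z. cmod (g z) powr r)"
      using f g False by (auto simp: Lp_def r_def)
    have le: "cmod (f z + g z) powr r \<le> 2 powr r * (cmod (f z) powr r + cmod (g z) powr r)" for z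
    proof -
      have "cmod (f z + g z) powr r \<le> (cmod (f z) + cmod (g z)) powr r"
        by (intro powr_mono2) (auto simp: r_def norm_triangle_ineq)
      also have "\<dots> \<le> 2 powr r * (cmod (f z) powr r + cmod (g z) powr r)"
        by (intro powr_add_le) (auto simp: r_def)
      finally show ?thesis .
    qed
    have "integrable torus (\<lambda>z. 2 powr r * (cmod (f z) powr r + cmod (g z) powr r))"
      using int by auto
    then have "integrable torus (\<lambda>z. cmod (f z + g z) powr r)"
      by (rule Bochner_Integration.integrable_bound) (use le in \<open>auto intro!: AE_I2\<close>)
    then show ?thesis
      using False by (auto simp: Lp_def r_def)
  qed
qed

lemma Lp_minus:
  assumes "f \<in> Lp p"
  shows "(\<lambda>z. - f z) \<in> Lp p"
  using assms by (auto simp: Lp_def)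

text \<open>Constants are integrable here, so for finite \<open>p\<close> domination suffices: by
  the constant 1 where the modulus is at most 1, by the power elsewhere, as
  \<open>r \<ge> 1\<close>.\<close>

lemma Lp_integrable:
  assumes f: "f \<in> Lp p" and p: "1 \<le> p"
  shows "integrable torus f"
proof -
  note [measurable] = LpD_measurable[OF f]
  show ?thesis
  proof (cases "p = \<infinity>")
    case True
    show ?thesis
      using Lp_top_AE_le[OF f[unfolded True]] by (intro torus.integrable_const_bound) auto
  next
    case False
    define r where "r = enn2real p"
    have r: "1 \<le> r"
      using one_le_enn2real[OF p False] by (simp add: r_def)
    have "integrable torus (\<lambda>z. 1 + cmod (f z) powr r)"
      using f False by (auto simp: Lp_def r_def)
    then show ?thesis
    proof (rule Bochner_Integration.integrable_bound)
      have "cmod (f z) \<le> 1 + cmod (f z) powr r" for z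
      proof (cases "cmod (f z) \<le> 1")
        case True
        then show ?thesis by (simp add: add_increasing2)
      next
        case False
        then have "cmod (f z) powr 1 \<le> cmod (f z) powr r"
          using r by (intro powr_mono) auto
        then show ?thesis by simp
      qed
      then show "AE z in torus. norm (f z) \<le> norm (1 + cmod (f z) powr r)"
        by (intro AE_I2) (simp add: add_nonneg_nonneg)
    qed simp
  qed
qed

section \<open>Comparison of the L^1 and L^p norms; norms of functions of constant modulus\<close>

lemma integral_norm_le_Lp_norm:
  fixes f :: "('d::finite \<Rightarrow> complex) \<Rightarrow> complex"
  assumes f: "f \<in> Lp p" and p: "1 \<le> p"
  shows "(LINT z|torus. cmod (f z)) \<le> Lp_norm p f"
proof -
  note [measurable] = LpD_measurable[OF f]
  have int1: "integrable torus (\<lambda>z. cmod (f z))"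
    using Lp_integrable[OF f p] by auto
  show ?thesis
  proof (cases "p = \<infinity>")
    case True
    have "(LINT z|torus. cmod (f z)) \<le> (LINT z|(torus :: ('d \<Rightarrow> complex) measure). Lp_norm \<infinity> f)"
      using Lp_top_AE_le[OF f[unfolded True]] int1 by (intro integral_mono_AE) auto
    then show ?thesis
      using True by (simp add: torus.prob_space)
  next
    case False
    define r where "r = enn2real p"
    have r: "1 \<le> r"
      using one_le_enn2real[OF p False] by (simp add: r_def)
    have intr: "integrable torus (\<lambda>z. cmod (f z) powr r)"
      using f False by (auto simp: Lp_def r_def)
    define J where "J = (LINT z|torus. cmod (f z) powr r)"
    define N where "N = J powr (1 / r)"
    have norm: "Lp_norm p f = N"
      using False by (simp add: Lp_norm_def N_def J_def r_def)
    have "0 \<le> J"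
      unfolding J_def by (rule integral_nonneg_AE) auto
    \<comment> \<open>Normalizing by \<open>N\<close> requires \<open>N > 0\<close>; a zero integral
      means that \<open>f\<close> vanishes almost everywhere.\<close>
    show ?thesis
    proof (cases "J = 0")
      case True
      then have "AE z in torus. cmod (f z) powr r = 0"
        using integral_nonneg_eq_0_iff_AE[OF intr] by (auto simp: J_def)
      then have "(LINT z|torus. cmod (f z)) = (LINT z|(torus :: ('d \<Rightarrow> complex) measure). 0)"
        by (intro integral_cong_AE) auto
      then show ?thesis
        by (simp add: norm N_def)
    next
      case False
      then have "0 < J" using \<open>0 \<le> J\<close> by simp
      then have N: "0 < N" "N powr r = J"
        using r by (auto simp: N_def powr_powr)
      \<comment> \<open>Young's inequality with weights \<open>1 / r\<close> and
        \<open>1 - 1 / r\<close> at the points \<open>t powr r\<close> and 1. Taken at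
        \<open>t = cmod (f z) / N\<close> and integrated, its right side becomes
        \<open>1 / r + (1 - 1 / r) = 1\<close>.\<close>
      have young: "t \<le> t powr r / r + (1 - 1 / r)" if "0 \<le> t" for t :: real
      \<comment> \<open>Young's inequality is applied at positive arguments; at 0 the claim reduces
        to \<open>1 / r \<le> 1\<close>.\<close>
      proof (cases "t = 0")
        case False
        then show ?thesis
          using Youngs_inequality_0[of "1 / r" "1 - 1 / r" "t powr r" 1] that r
          by (simp add: powr_powr)
      qed (use r in simp)
      have "cmod (f z) / N \<le> cmod (f z) powr r / (r * J) + (1 - 1 / r)" for z
        using young[of "cmod (f z) / N"] N by (simp add: powr_divide mult.commute)
      then have "(LINT z|torus. cmod (f z) / N) \<le>
          (LINT z|torus. cmod (f z) powr r / (r * J) + (1 - 1 / r))"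
        using int1 intr by (intro integral_mono) auto
      also have "\<dots> = J / (r * J) + (1 - 1 / r)"
        using intr by (simp add: torus.prob_space J_def)
      also have "\<dots> = 1"
        using \<open>0 < J\<close> r by (simp add: field_simps)
      finally show ?thesis
        using N norm by (simp add: field_simps)
    qed
  qed
qed

text \<open>A probability space is not null, so an almost everywhere statement free of
  \<open>z\<close> holds outright.\<close>

lemma AE_norm_const_nonneg:
  fixes f :: "('d::finite \<Rightarrow> complex) \<Rightarrow> complex"
  assumes "AE z in torus. cmod (f z) = c"
  shows "0 \<le> c"
proof -
  have "AE z in (torus :: ('d \<Rightarrow> complex) measure). 0 \<le> c"
    using assms by eventually_elim auto
  then show ?thesis by simp
qed

lemma Lp_norm_AE_const:
  fixes f :: "('d::finite \<Rightarrow> complex) \<Rightarrow> complex"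
  assumes [measurable]: "f \<in> borel_measurable torus"
    and const: "AE z in torus. cmod (f z) = c" and p: "1 \<le> p"
  shows "Lp_norm p f = c"
proof -
  have c: "0 \<le> c"
    by (rule AE_norm_const_nonneg[OF const])
  show ?thesis
  proof (cases "p = \<infinity>")
    case True
    have "esssup torus (\<lambda>z. ennreal (cmod (f z))) = esssup (torus :: ('d \<Rightarrow> complex) measure) (\<lambda>z. ennreal c)"
      using const by (intro esssup_AE_cong) (auto elim!: eventually_mono)
    also have "\<dots> = ennreal c"
      by (rule esssup_const) (simp add: torus.emeasure_space_1)
    finally show ?thesis
      using True c by (simp add: Lp_norm_def)
  next
    case False
    \<comment> \<open>A nonzero exponent lets \<open>powr enn2real p\<close> and
      \<open>powr (1 / enn2real p)\<close> cancel on the nonnegative \<open>c\<close>.\<close>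
    then have r: "1 \<le> enn2real p"
      by (rule one_le_enn2real[OF p])
    have "(LINT z|torus. cmod (f z) powr enn2real p) = (LINT z|(torus :: ('d \<Rightarrow> complex) measure). c powr enn2real p)"
      using const by (intro integral_cong_AE) (auto elim!: eventually_mono)
    then show ?thesis
      using False r c by (simp add: Lp_norm_def torus.prob_space powr_powr)
  qed
qed

section \<open>Monomials and analytic polynomials on the torus\<close>

lemma norm_monomial: "z \<in> space torus \<Longrightarrow> cmod (monomial \<alpha> z) = 1"
  by (auto simp: monomial_def space_torus prod_norm[symmetric] norm_power_int)

lemma monomial_measurable [measurable]: "monomial \<alpha> \<in> borel_measurable torus"
proof -
  \<comment> \<open>\<open>circle\<close> carries the Borel sets restricted to the unit sphere;
    coordinates become complex-valued Borel functions by composing with the inclusion into the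
    plane.\<close>
  have "(\<lambda>x. x) \<in> measurable circle borel"
    by (simp add: circle_def measurable_def space_restrict_space sets_restrict_space) blast
  moreover have "(\<lambda>z. z i) \<in> measurable torus circle" for i :: 'a
    unfolding torus_def by (rule measurable_component_singleton) simp
  ultimately have [measurable]: "(\<lambda>z. z i) \<in> borel_measurable torus" for i :: 'a
    by (rule measurable_compose[rotated])
  show ?thesis
    unfolding monomial_def power_int_def by measurable
qed

lemma analytic_polynomial_Lp:
  assumes "analytic_polynomial g"
  shows "g \<in> Lp p"
proof -
  obtain A c where g: "g = (\<lambda>z. \<Sum>\<alpha>\<in>A. c \<alpha> * monomial \<alpha> z)"
    using assms by (auto simp: analytic_polynomial_def)
  \<comment> \<open>Monomials are unimodular on the torus, which leaves the coefficients as a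
    uniform bound.\<close>
  have "cmod (g z) \<le> (\<Sum>\<alpha>\<in>A. cmod (c \<alpha>))" if "z \<in> space torus" for z
    unfolding g
    by (rule order_trans[OF norm_sum]) (simp add: norm_mult norm_monomial that)
  moreover have "g \<in> borel_measurable torus"
    unfolding g by measurable
  ultimately show ?thesis
    by (intro Lp_bounded AE_I2) auto
qed

section \<open>Pairing against a function of constant modulus\<close>

lemma integrable_mult_cnj:
  assumes f: "integrable torus f" and [measurable]: "\<phi> \<in> borel_measurable torus"
    and const: "AE z in torus. cmod (\<phi> z) = c"
  shows "integrable torus (\<lambda>z. f z * cnj (\<phi> z))"
proof -
  have [measurable]: "f \<in> borel_measurable torus"
    using f by auto
  have "(\<lambda>z. cnj (\<phi> z)) \<in> borel_measurable torus"
    using continuous_on_cnj[OF continuous_on_id]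
    by (intro borel_measurable_continuous_on[where f = cnj]) auto
  then have [measurable]: "(\<lambda>z. f z * cnj (\<phi> z)) \<in> borel_measurable torus"
    by measurable
  have "integrable torus (\<lambda>z. c * cmod (f z))"
    using f by auto
  then show ?thesis
    by (rule Bochner_Integration.integrable_bound)
      (use const in \<open>auto elim!: eventually_mono simp: norm_mult\<close>)
qed

text \<open>The constant modulus pulls \<open>c\<close> out of the integral, so the L^1 norm
  controls the pairing and one estimate serves all exponents \<open>p \<ge> 1\<close>, without a
  conjugate exponent.\<close>

lemma norm_pairing_le:
  assumes f: "f \<in> Lp p" and p: "1 \<le> p" and \<phi>: "\<phi> \<in> borel_measurable torus"
    and const: "AE z in torus. cmod (\<phi> z) = c"
  shows "cmod (pairing f \<phi>) \<le> Lp_norm p f * c"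
proof -
  have int: "integrable torus f"
    by (rule Lp_integrable[OF f p])
  have int': "integrable torus (\<lambda>z. f z * cnj (\<phi> z))"
    by (rule integrable_mult_cnj[OF int \<phi> const])
  have c: "0 \<le> c"
    by (rule AE_norm_const_nonneg[OF const])
  have "cmod (pairing f \<phi>) \<le> (LINT z|torus. cmod (f z * cnj (\<phi> z)))"
    unfolding pairing_def by (rule integral_norm_bound)
  also have "\<dots> = (LINT z|torus. cmod (f z) * c)"
    using const \<phi> borel_measurable_integrable[OF int] borel_measurable_integrable[OF int']
    by (intro integral_cong_AE) (auto elim!: eventually_mono simp: norm_mult)
  also have "\<dots> = (LINT z|torus. cmod (f z)) * c"
    by simp
  also have "\<dots> \<le> Lp_norm p f * c"
    using integral_norm_le_Lp_norm[OF f p] c by (rule mult_right_mono)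
  finally show ?thesis .
qed

text \<open>Integrability of both products matters: the integral of a nonintegrable function
  defaults to 0, and additivity could fail.\<close>

lemma pairing_add:
  assumes "integrable torus f" "integrable torus g"
    and "\<phi> \<in> borel_measurable torus" "AE z in torus. cmod (\<phi> z) = c"
  shows "pairing (\<lambda>z. f z + g z) \<phi> = pairing f \<phi> + pairing g \<phi>"
  using integrable_mult_cnj[OF assms(1,3,4)] integrable_mult_cnj[OF assms(2,3,4)]
  by (simp add: pairing_def distrib_right)

lemma pairing_self:
  fixes \<phi> :: "('d::finite \<Rightarrow> complex) \<Rightarrow> complex"
  assumes [measurable]: "\<phi> \<in> borel_measurable torus"
    and const: "AE z in torus. cmod (\<phi> z) = c"
  shows "pairing \<phi> \<phi> = of_real (c\<^sup>2)"
proof -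
  have "pairing \<phi> \<phi> = (LINT z|torus. complex_of_real ((cmod (\<phi> z))\<^sup>2))"
    by (simp only: pairing_def complex_norm_square)
  also have "\<dots> = (LINT z|(torus :: ('d \<Rightarrow> complex) measure). complex_of_real (c\<^sup>2))"
    using const by (intro integral_cong_AE) (auto elim!: eventually_mono)
  finally show ?thesis
    by (simp add: torus.prob_space)
qed

text \<open>Reconciles the two meanings of orthogonality: for \<open>p < 2\<close> the pairing
  vanishes on the approximating polynomials and is continuous in the norm of \<open>Lp p\<close>, so
  it vanishes on their limit.\<close>

lemma orthogonal_to_pairing:
  assumes orth: "orthogonal_to p f \<phi>" and f: "f \<in> Lp p" and p: "1 \<le> p"
    and \<phi>: "\<phi> \<in> borel_measurable torus" and const: "AE z in torus. cmod (\<phi> z) = c" and c: "0 < c"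
  shows "pairing f \<phi> = 0"
proof (cases "p < 2")
  case False
  then show ?thesis
    using orth by (simp add: orthogonal_to_def)
next
  case True
  have "cmod (pairing f \<phi>) \<le> e" if "0 < e" for e
  proof -
    \<comment> \<open>The tolerance \<open>e / c\<close> offsets the factor \<open>c\<close> in
      \<open>norm_pairing_le\<close>.\<close>
    have "0 < e / c" using that c by simp
    then obtain g where g: "analytic_polynomial g" "pairing g \<phi> = 0"
      and less: "Lp_norm p (\<lambda>z. f z - g z) < e / c"
      using orth True unfolding orthogonal_to_def Hardy_closure_def by fastforce
    have gL: "g \<in> Lp p"
      by (rule analytic_polynomial_Lp[OF g(1)])
    have diff: "(\<lambda>z. f z - g z) \<in> Lp p"
      using Lp_add[OF f Lp_minus[OF gL]] by simp
    have "pairing f \<phi> = pairing (\<lambda>z. f z - g z) \<phi>"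
      using pairing_add[OF Lp_integrable[OF diff p] Lp_integrable[OF gL p] \<phi> const] g(2) by simp
    also have "cmod \<dots> \<le> Lp_norm p (\<lambda>z. f z - g z) * c"
      by (rule norm_pairing_le[OF diff p \<phi> const])
    also have "\<dots> \<le> e"
      using less c by (simp add: field_simps)
    finally show ?thesis .
  qed
  then have "cmod (pairing f \<phi>) \<le> 0"
    by (rule field_le_epsilon) simp
  then show ?thesis by simp
qed

theorem corollary2p5:
  fixes I \<phi> :: "('d::finite \<Rightarrow> complex) \<Rightarrow> complex" and C :: complex and p :: ennreal
  assumes "C \<noteq> 0"
    and "inner_function I"
    and "\<phi> = (\<lambda>z. C * I z)"
    and "1 \<le> p"
  shows "Hilbert_point p \<phi>"
proof -
  let ?c = "cmod C"
  \<comment> \<open>The exponent \<open>q\<close> may differ from \<open>p\<close>; what is kept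
    from it is measurability and the vanishing of Fourier coefficients, neither of which refers to
    the exponent.\<close>
  obtain q where I: "I \<in> Hardy q"
    using assms(2) by (auto simp: inner_function_def)
  then have [measurable]: "I \<in> borel_measurable torus"
    by (simp add: Hardy_def Lp_def)
  have \<phi>: "\<phi> \<in> borel_measurable torus"
    unfolding assms(3) by measurable
  have const: "AE z in torus. cmod (\<phi> z) = ?c"
    using assms(2) by (auto simp: inner_function_def assms(3) norm_mult elim!: eventually_mono)
  have c: "0 < ?c"
    using assms(1) by simp
  have Lp: "\<phi> \<in> Lp p"
    using const by (intro Lp_bounded[OF \<phi>, of ?c]) (auto elim!: eventually_mono)
  \<comment> \<open>Scaling preserves the vanishing Fourier coefficients; boundedness has already
    supplied membership for the exponent \<open>p\<close>.\<close>
  have "fourier_coeff \<phi> \<alpha> = C * fourier_coeff I \<alpha>" for \<alpha>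
    by (simp add: fourier_coeff_def assms(3) mult.assoc)
  then have Hardy: "\<phi> \<in> Hardy p"
    using I Lp by (simp add: Hardy_def)
  have nontrivial: "\<not> (AE z in torus. \<phi> z = 0)"
  proof
    assume "AE z in torus. \<phi> z = 0"
    \<comment> \<open>At almost every point both conditions would hold, forcing
      \<open>cmod C = 0\<close>.\<close>
    with const have "AE z in (torus :: ('d \<Rightarrow> complex) measure). False"
      by eventually_elim (use c in simp)
    then show False by (simp add: torus.AE_False)
  qed
  have "Lp_norm p \<phi> \<le> Lp_norm p (\<lambda>z. \<phi> z + f z)"
    if "f \<in> Hardy p" and orth: "orthogonal_to p f \<phi>" for f
  proof -
    have f: "f \<in> Lp p"
      using that(1) by (simp add: Hardy_def)
    have "pairing (\<lambda>z. \<phi> z + f z) \<phi> = pairing \<phi> \<phi> + pairing f \<phi>"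
      by (rule pairing_add[OF Lp_integrable[OF Lp assms(4)] Lp_integrable[OF f assms(4)] \<phi> const])
    also have "\<dots> = of_real (?c\<^sup>2)"
      by (simp add: pairing_self[OF \<phi> const] orthogonal_to_pairing[OF orth f assms(4) \<phi> const c])
    \<comment> \<open>The pairing has modulus \<open>?c\<close> squared, and its upper bound carries
      one factor \<open>?c\<close>; cancelling it leaves \<open>?c\<close>, which is the norm of
      \<open>\<phi>\<close>.\<close>
    finally have "?c * ?c \<le> Lp_norm p (\<lambda>z. \<phi> z + f z) * ?c"
      using norm_pairing_le[OF Lp_add[OF Lp f] assms(4) \<phi> const]
      by (simp add: norm_power power2_eq_square norm_mult)
    then show ?thesis
      using c by (simp add: Lp_norm_AE_const[OF \<phi> const assms(4)])
  qed
  then show ?thesis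
    using assms(4) Hardy nontrivial by (simp add: Hilbert_point_def)
qed

end
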